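(* Let $r\ge 1$ and let $T:S_n(\mathbb{R})\to S_n(\mathbb{R})$ be the linear transformation $T(A)=\sum_{k=1}^r\operatorname{tr}(AB_k)U_k$, where $B_1,\ldots,B_r\in S_n(\mathbb{R})$ and $U_1,\ldots,U_r\in S_n(\mathbb{R})$ are linearly independent and all positive definite. Suppose that for every choice of $\ell_1,\ldots,\ell_r$ with $\ell_k\in\{\lambda_{\min}(U_k),\lambda_{\max}(U_k)\}$ for each $k$ (the choices for different $k$ being independent), the matrix $\sum_{k=1}^r\ell_kB_k$ is non-zero and positive semi-definite. Then $T$ is positive definite preserving.
   Context: $S_n(\mathbb{R})$ is the real vector space of real symmetric $n\times n$ matrices. For $X\in S_n(\mathbb{R})$, $\lambda_{\min}(X)$ and $\lambda_{\max}(X)$ denote the smallest and largest eigenvalues of $X$. A linear transformation $T:S_n(\mathbb{R})\to S_n(\mathbb{R})$ is called positive definite preserving if $T(A)$ is positive definite whenever $A\in S_n(\mathbb{R})$ is positive definite. *)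

theory Defs
  imports "HOL-Analysis.Analysis"
begin

definition sym_matrices :: "(real ^ 'n ^ 'n) set" where
  "sym_matrices = {A. transpose A = A}"

definition positive_semidefinite :: "real ^ 'n ^ 'n \<Rightarrow> bool" where
  "positive_semidefinite A \<longleftrightarrow> A \<in> sym_matrices \<and> (\<forall>x. 0 \<le> x \<bullet> (A *v x))"

definition positive_definite :: "real ^ 'n ^ 'n \<Rightarrow> bool" where
  "positive_definite A \<longleftrightarrow> A \<in> sym_matrices \<and> (\<forall>x. x \<noteq> 0 \<longrightarrow> 0 < x \<bullet> (A *v x))"

definition eigenvalues :: "real ^ 'n ^ 'n \<Rightarrow> real set" where
  "eigenvalues A = {\<mu>. \<exists>v. v \<noteq> 0 \<and> A *v v = \<mu> *\<^sub>R v}"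

text \<open>
  The next two are only used for symmetric matrices, whose eigenvalues form a finite
  non-empty set of reals; otherwise \<^const>\<open>Min\<close> and \<^const>\<open>Max\<close> are not meaningful.
\<close>

definition lambda_min :: "real ^ 'n ^ 'n \<Rightarrow> real" where
  "lambda_min A = Min (eigenvalues A)"

definition lambda_max :: "real ^ 'n ^ 'n \<Rightarrow> real" where
  "lambda_max A = Max (eigenvalues A)"

text \<open>
  Maps on the subspace of symmetric matrices are represented by functions on all matrices,
  of which only the values on symmetric arguments matter.
\<close>

definition sym_linear :: "(real ^ 'n ^ 'n \<Rightarrow> real ^ 'n ^ 'n) \<Rightarrow> bool" where
  "sym_linear T \<longleftrightarrow>
     (\<forall>A \<in> sym_matrices. T A \<in> sym_matrices) \<and>
     (\<forall>A \<in> sym_matrices. \<forall>B \<in> sym_matrices. T (A + B) = T A + T B) \<and>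
     (\<forall>c. \<forall>A \<in> sym_matrices. T (c *\<^sub>R A) = c *\<^sub>R T A)"

definition positive_definite_preserving ::
  "(real ^ 'n ^ 'n \<Rightarrow> real ^ 'n ^ 'n) \<Rightarrow> bool" where
  "positive_definite_preserving T \<longleftrightarrow>
     sym_linear T \<and>
     (\<forall>A \<in> sym_matrices. positive_definite A \<longrightarrow> positive_definite (T A))"

end

theory Submission
  imports Defs
begin

text \<open>
  For positive definite \<open>A\<close> and \<open>x \<noteq> 0\<close> put \<open>t k = trace (A ** B k)\<close>. Choosing \<open>l k\<close> as the smallest or
  the largest eigenvalue of \<open>U k\<close> according to the sign of \<open>t k\<close>, the Rayleigh bounds give
  \<open>t k * (x \<bullet> (U k *v x)) \<ge> t k * l k * (x \<bullet> x)\<close>. Summing over \<open>k\<close> bounds \<open>x \<bullet> (T A *v x)\<close> from below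
  by \<open>(x \<bullet> x) * trace (A ** C)\<close> with \<open>C = (\<Sum>k. l k *\<^sub>R B k)\<close>, and this trace is positive because \<open>A\<close> is
  positive definite and \<open>C\<close> is non-zero and positive semidefinite.
\<close>

lemma sym_matrices_inner:
  "A \<in> sym_matrices \<Longrightarrow> x \<bullet> (A *v y) = (A *v x) \<bullet> (y :: real ^ 'n)"
  by (metis (mono_tags) dot_lmul_matrix mem_Collect_eq sym_matrices_def transpose_matrix_vector)

lemma trace_scaleR: "trace (c *\<^sub>R A) = c * trace (A :: real ^ 'n ^ 'n)"
  by (simp add: trace_def sum_distrib_left)

lemma matrix_add_rdistrib: "(A + B) ** C = A ** C + B ** (C :: real ^ 'n ^ 'm)"
  by (simp add: matrix_matrix_mult_def vec_eq_iff distrib_right sum.distrib)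

lemma transpose_scaleR: "transpose (c *\<^sub>R A) = c *\<^sub>R transpose (A :: real ^ 'n ^ 'n)"
  by (simp add: transpose_def vec_eq_iff)

lemma transpose_add: "transpose (A + B) = transpose A + transpose (B :: real ^ 'n ^ 'm)"
  by (simp add: transpose_def vec_eq_iff)

lemma subspace_sym_matrices: "subspace (sym_matrices :: (real ^ 'n ^ 'n) set)"
  unfolding subspace_def sym_matrices_def
  by (auto simp: transpose_scaleR transpose_add) (simp add: transpose_def vec_eq_iff)

lemma mat_1_in_sym_matrices: "(mat 1 :: real ^ 'n ^ 'n) \<in> sym_matrices"
  by (simp add: sym_matrices_def)

text \<open>Were \<open>M *v v\<close> a non-zero \<open>y\<close>, the quadratic form along the
  line \<open>y + t *\<^sub>R v\<close> would have no \<open>t\<close>-squared term, so it would be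
  affine in \<open>t\<close> with slope \<open>2 * (y \<bullet> y)\<close> and become negative
  somewhere.\<close>

lemma positive_semidefinite_null:
  fixes M :: "real ^ 'n ^ 'n"
  assumes M: "positive_semidefinite M" and v: "v \<bullet> (M *v v) = 0"
  shows "M *v v = 0"
proof (rule ccontr)
  assume "M *v v \<noteq> 0"
  define y where "y = M *v v"
  \<comment> \<open>Solves
    \<open>y \<bullet> (M *v y) + 2 * t * (y \<bullet> y) = - 1\<close>.\<close>
  define t where "t = - (y \<bullet> (M *v y) + 1) / (2 * (y \<bullet> y))"
  have S: "M \<in> sym_matrices" and nonneg: "0 \<le> x \<bullet> (M *v x)" for x
    using M by (auto simp: positive_semidefinite_def)
  have yy: "y \<bullet> y > 0"
    using \<open>M *v v \<noteq> 0\<close> by (simp add: y_def)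
  have "(y + t *\<^sub>R v) \<bullet> (M *v (y + t *\<^sub>R v)) = y \<bullet> (M *v y) + 2 * t * (y \<bullet> y)"
    using v sym_matrices_inner[OF S, of v y]
    by (simp add: matrix_vector_right_distrib matrix_vector_mult_scaleR inner_add_left
        inner_add_right y_def)
  also have "\<dots> = - 1"
    using yy by (simp add: t_def field_simps)
  finally show False
    using nonneg[of "y + t *\<^sub>R v"] by simp
qed

text \<open>Eigenvectors for distinct eigenvalues are orthogonal, hence independent, so one
  eigenvector per eigenvalue gives a finite set. Finiteness is what makes \<open>Min\<close> and
  \<open>Max\<close> of the spectrum genuine bounds.\<close>

lemma finite_eigenvalues:
  fixes U :: "real ^ 'n ^ 'n"
  assumes S: "U \<in> sym_matrices"
  shows "finite (eigenvalues U)"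
proof -
  define e where "e \<mu> = (SOME v. v \<noteq> 0 \<and> U *v v = \<mu> *\<^sub>R v)" for \<mu>
  have e: "e \<mu> \<noteq> 0" "U *v e \<mu> = \<mu> *\<^sub>R e \<mu>" if "\<mu> \<in> eigenvalues U" for \<mu>
    using someI_ex[of "\<lambda>v. v \<noteq> 0 \<and> U *v v = \<mu> *\<^sub>R v"] that
    unfolding eigenvalues_def e_def by auto
  have orth: "e \<mu> \<bullet> e \<nu> = 0"
    if "\<mu> \<in> eigenvalues U" "\<nu> \<in> eigenvalues U" "\<mu> \<noteq> \<nu>" for \<mu> \<nu>
    using sym_matrices_inner[OF S, of "e \<mu>" "e \<nu>"] e[OF that(1)] e[OF that(2)] that(3) by auto
  have inj: "inj_on e (eigenvalues U)"
    by (rule inj_onI) (metis orth e(1) inner_eq_zero_iff)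
  have "pairwise orthogonal (e ` eigenvalues U)"
    unfolding pairwise_def orthogonal_def using orth by blast
  moreover have "0 \<notin> e ` eigenvalues U"
    using e(1) by force
  ultimately have "finite (e ` eigenvalues U)"
    using pairwise_orthogonal_independent independent_imp_finite by blast
  then show ?thesis
    using finite_imageD inj by blast
qed

text \<open>By compactness the quadratic form attains a minimum \<open>m\<close> on the unit sphere,
  and any minimizer turns out to be an eigenvector for \<open>m\<close>.\<close>

lemma Rayleigh_min_eigenvalue:
  fixes U :: "real ^ 'n ^ 'n"
  assumes S: "U \<in> sym_matrices"
  obtains m where "m \<in> eigenvalues U" "\<And>x. m * (x \<bullet> x) \<le> x \<bullet> (U *v x)"
proof -
  have "(\<exists>v \<in> sphere 0 1. \<forall>y \<in> sphere 0 1. v \<bullet> (U *v v) \<le> y \<bullet> (U *v y))"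
  proof (rule continuous_attains_inf)
    show "sphere 0 1 \<noteq> ({} :: (real ^ 'n) set)"
      by simp
    show "continuous_on (sphere 0 1) (\<lambda>y. y \<bullet> (U *v y))"
      by (intro continuous_intros)
  qed auto
  then obtain v where v: "norm v = 1" and min: "\<And>y. norm y = 1 \<Longrightarrow> v \<bullet> (U *v v) \<le> y \<bullet> (U *v y)"
    by auto
  define m where "m = v \<bullet> (U *v v)"
  have bound: "m * (x \<bullet> x) \<le> x \<bullet> (U *v x)" for x
  proof (cases "x = 0")
    case False
    \<comment> \<open>The form is homogeneous of degree two, so the bound on the sphere extends to
      every non-zero \<open>x\<close>.\<close>
    have "m \<le> (x /\<^sub>R norm x) \<bullet> (U *v (x /\<^sub>R norm x))"
      unfolding m_def using False by (intro min) simp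
    also have "\<dots> = (x \<bullet> (U *v x)) / (x \<bullet> x)"
      by (simp add: matrix_vector_mult_scaleR dot_square_norm power2_eq_square divide_simps)
    finally show ?thesis
      using False by (simp add: pos_le_divide_eq)
  qed simp
  \<comment> \<open>Shifting by \<open>m\<close> makes the form positive semidefinite and zero at
    the minimizer \<open>v\<close>, so \<open>v\<close> lies in the kernel of \<open>M\<close>. This
    replaces Lagrange multipliers.\<close>
  define M where "M = U - m *\<^sub>R mat 1"
  have Mv: "M *v x = U *v x - m *\<^sub>R x" for x
    by (simp add: M_def matrix_vector_mult_diff_rdistrib flip: scaleR_matrix_vector_assoc)
  have "M \<in> sym_matrices"
    unfolding M_def
    by (intro subspace_diff subspace_scale subspace_sym_matrices S mat_1_in_sym_matrices)
  then have "positive_semidefinite M"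
    using bound by (simp add: positive_semidefinite_def Mv inner_diff_right)
  moreover have "v \<bullet> (M *v v) = 0"
    using v by (simp add: Mv inner_diff_right m_def dot_square_norm)
  ultimately have "M *v v = 0"
    by (rule positive_semidefinite_null)
  then have "m \<in> eigenvalues U"
    unfolding eigenvalues_def using v by (auto simp: Mv intro!: exI[of _ v])
  with bound show ?thesis
    using that by blast
qed

lemma lambda_min_le_Rayleigh:
  fixes U :: "real ^ 'n ^ 'n"
  assumes S: "U \<in> sym_matrices"
  shows "lambda_min U * (x \<bullet> x) \<le> x \<bullet> (U *v x)"
proof -
  obtain m where m: "m \<in> eigenvalues U" "\<And>x. m * (x \<bullet> x) \<le> x \<bullet> (U *v x)"
    using Rayleigh_min_eigenvalue[OF S] by blast
  \<comment> \<open>The Rayleigh bound for the eigenvalue \<open>m\<close> passes to the smaller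
    \<open>lambda_min U\<close> because \<open>x \<bullet> x\<close> is non-negative.\<close>
  have "lambda_min U \<le> m"
    unfolding lambda_min_def by (intro Min_le finite_eigenvalues S m)
  then show ?thesis
    by (meson m(2) inner_ge_zero mult_right_mono order_trans)
qed

lemma Rayleigh_le_lambda_max:
  fixes U :: "real ^ 'n ^ 'n"
  assumes S: "U \<in> sym_matrices"
  shows "x \<bullet> (U *v x) \<le> lambda_max U * (x \<bullet> x)"
proof -
  have neg: "(- U) *v y = - (U *v y)" for y
    using scaleR_matrix_vector_assoc[of "- 1" U y] by simp
  \<comment> \<open>Negation turns the upper bound into the lower bound for \<open>- U\<close>,
    whose eigenvalues are the negatives of those of \<open>U\<close>.\<close>
  have "- U \<in> sym_matrices"
    by (intro subspace_neg subspace_sym_matrices S)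
  then obtain m where m: "m \<in> eigenvalues (- U)" "\<And>x. m * (x \<bullet> x) \<le> x \<bullet> ((- U) *v x)"
    using Rayleigh_min_eigenvalue by blast
  then have "- m \<in> eigenvalues U"
    by (auto simp: eigenvalues_def neg) (metis minus_minus)
  then have "- m \<le> lambda_max U"
    unfolding lambda_max_def by (intro Max_ge finite_eigenvalues S)
  then have "- m * (x \<bullet> x) \<le> lambda_max U * (x \<bullet> x)"
    by (intro mult_right_mono) auto
  with m(2)[of x] show ?thesis
    by (simp add: neg)
qed

text \<open>
  Subtracting \<open>w w\<^sup>T / (v \<bullet> w)\<close> with \<open>w = C *v v\<close> keeps \<open>C\<close> positive semidefinite and adds \<open>v\<close> to its
  kernel, so induction on the codimension of the kernel writes \<open>C\<close> as a sum of rank-one matrices.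
\<close>

lemma trace_positive_definite_mult:
  fixes A C :: "real ^ 'n ^ 'n"
  assumes A: "positive_definite A" and "positive_semidefinite C"
  shows "0 \<le> trace (A ** C) \<and> (C \<noteq> 0 \<longrightarrow> 0 < trace (A ** C))"
  using assms(2)
proof (induction "CARD('n) - dim {x. C *v x = 0}" arbitrary: C rule: less_induct)
  case less
  note C = less.prems
  have S: "C \<in> sym_matrices" and nonneg: "0 \<le> x \<bullet> (C *v x)" for x
    using C by (auto simp: positive_semidefinite_def)
  show ?case
  proof (cases "C = 0")
    case True
    then show ?thesis
      by (simp add: trace_def)
  next
    case False
    obtain v where v: "C *v v \<noteq> 0"
      using False by (metis matrix_eq matrix_vector_mult_0)
    define w where "w = C *v v"
    define d where "d = v \<bullet> w"
    \<comment> \<open>A zero value of the form at \<open>v\<close> would force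
      \<open>C *v v = 0\<close>.\<close>
    have d: "d > 0"
      using positive_semidefinite_null[OF C, of v] nonneg[of v] v unfolding d_def w_def by fastforce
    define W :: "real ^ 'n ^ 'n" where "W = (\<chi> i j. w $ i * w $ j)"
    define D where "D = C - (1 / d) *\<^sub>R W"
    have W: "W *v x = (w \<bullet> x) *\<^sub>R w" for x
      by (simp add: W_def vec_eq_iff matrix_vector_mult_def inner_vec_def sum_distrib_left
          mult_ac)
    have Dv: "D *v x = C *v x - ((w \<bullet> x) / d) *\<^sub>R w" for x
      by (simp add: D_def matrix_vector_mult_diff_rdistrib W flip: scaleR_matrix_vector_assoc)
    have "W \<in> sym_matrices"
      by (simp add: W_def sym_matrices_def transpose_def mult.commute)
    then have "D \<in> sym_matrices"
      unfolding D_def by (intro subspace_diff subspace_scale subspace_sym_matrices S)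
    moreover have "0 \<le> x \<bullet> (D *v x)" for x
    proof -
      define c where "c = (w \<bullet> x) / d"
      \<comment> \<open>Completing the square: the form of \<open>D\<close> at \<open>x\<close> is
        the form of \<open>C\<close> at \<open>x\<close> with its \<open>C\<close>-orthogonal
        projection onto \<open>v\<close> removed.\<close>
      have "x \<bullet> (D *v x) = (x - c *\<^sub>R v) \<bullet> (C *v (x - c *\<^sub>R v))"
        using d sym_matrices_inner[OF S, of v x]
        by (simp add: Dv matrix_vector_mult_diff_distrib matrix_vector_mult_scaleR inner_diff_left
            inner_diff_right inner_commute flip: w_def d_def c_def)
          (simp add: c_def inner_commute)
      then show ?thesis
        using nonneg by simp
    qed
    ultimately have D: "positive_semidefinite D"
      by (simp add: positive_semidefinite_def)
    have ker_subspace: "subspace {x. M *v x = 0}" for M :: "real ^ 'n ^ 'n"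
      by (simp add: subspace_def matrix_vector_right_distrib matrix_vector_mult_scaleR)
    have "w \<bullet> x = 0" if "C *v x = 0" for x
      using sym_matrices_inner[OF S, of v x] that by (simp add: w_def)
    then have sub: "{x. C *v x = 0} \<subseteq> {x. D *v x = 0}"
      by (auto simp: Dv)
    \<comment> \<open>Here \<open>w \<bullet> v = d\<close>, so the correction cancels
      \<open>C *v v = w\<close>; since \<open>w\<close> is non-zero, the kernel grows
      strictly.\<close>
    have "v \<in> {x. D *v x = 0}"
      using d by (simp add: Dv inner_commute flip: w_def d_def)
    with v sub have "{x. C *v x = 0} \<subset> {x. D *v x = 0}"
      by blast
    then have "dim {x. C *v x = 0} < dim {x. D *v x = 0}"
      by (intro dim_psubset) (simp add: span_eq_iff[THEN iffD2, OF ker_subspace])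
    \<comment> \<open>The measure uses truncated subtraction, so a strict decrease also needs this
      bound.\<close>
    moreover have "dim {x. D *v x = 0} \<le> CARD('n)"
      by (metis dim_subset_UNIV DIM_cart DIM_real mult_1_right)
    ultimately have "0 \<le> trace (A ** D)"
      using less.hyps[of D] D by (simp add: diff_less_mono2)
    \<comment> \<open>Strict positivity comes from the rank-one term alone; from the induction
      hypothesis the non-negative part suffices, which covers \<open>D = 0\<close>.\<close>
    moreover have "trace (A ** C) = trace (A ** D) + (w \<bullet> (A *v w)) / d"
    proof -
      have "trace (A ** W) = w \<bullet> (A *v w)"
        by (simp add: trace_def W_def matrix_matrix_mult_def matrix_vector_mult_def inner_vec_def
            sum_distrib_left mult_ac)
      moreover have "A ** C = A ** (D + (1 / d) *\<^sub>R W)"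
        by (simp add: D_def)
      then have "A ** C = A ** D + (1 / d) *\<^sub>R (A ** W)"
        by (simp add: matrix_add_ldistrib matrix_scalar_ac scalar_matrix_assoc)
      ultimately show ?thesis
        by (simp add: trace_add trace_scaleR)
    qed
    moreover have "w \<bullet> (A *v w) > 0"
      using A v by (simp add: positive_definite_def w_def)
    ultimately show ?thesis
      using d by (simp add: add_nonneg_pos)
  qed
qed

lemma sum_matrix_mult_right: "A ** (\<Sum>k\<in>K. f k) = (\<Sum>k\<in>K. A ** (f k :: real ^ 'n ^ 'n))"
  for A :: "real ^ 'n ^ 'n"
  by (induction K rule: infinite_finite_induct) (simp_all add: matrix_add_ldistrib)

lemma trace_sum: "trace (\<Sum>k\<in>K. f k) = (\<Sum>k\<in>K. trace (f k :: real ^ 'n ^ 'n))"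
  by (simp add: trace_def) (rule sum.swap)

lemma sum_matrix_vector_mult: "(\<Sum>k\<in>K. f k) *v x = (\<Sum>k\<in>K. (f k :: real ^ 'n ^ 'n) *v x)"
  by (induction K rule: infinite_finite_induct) (simp_all add: matrix_vector_mult_add_rdistrib)

theorem theorem3p5:
  fixes r :: nat
    and T :: "real ^ 'n ^ 'n \<Rightarrow> real ^ 'n ^ 'n"
    and B U :: "nat \<Rightarrow> real ^ 'n ^ 'n"
  assumes "r \<ge> 1"
    and "\<And>k. k \<in> {1..r} \<Longrightarrow> B k \<in> sym_matrices"
    and "\<And>k. k \<in> {1..r} \<Longrightarrow> U k \<in> sym_matrices"
    and "inj_on U {1..r}" and "independent (U ` {1..r})"
    and "\<And>k. k \<in> {1..r} \<Longrightarrow> positive_definite (U k)"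
    and "\<And>A. A \<in> sym_matrices \<Longrightarrow> T A = (\<Sum>k = 1..r. trace (A ** B k) *\<^sub>R U k)"
    and "\<And>l :: nat \<Rightarrow> real.
           (\<And>k. k \<in> {1..r} \<Longrightarrow> l k \<in> {lambda_min (U k), lambda_max (U k)}) \<Longrightarrow>
           (\<Sum>k = 1..r. l k *\<^sub>R B k) \<noteq> 0 \<and>
           positive_semidefinite (\<Sum>k = 1..r. l k *\<^sub>R B k)"
  shows "positive_definite_preserving T"
proof -
  note B = assms(2) and U = assms(3) and T = assms(7) and pos = assms(8)
  have T_sym: "T A \<in> sym_matrices" if "A \<in> sym_matrices" for A
    unfolding T[OF that] using U
    by (intro subspace_sum subspace_scale subspace_sym_matrices) auto
  have "sym_linear T"
    unfolding sym_linear_def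
  proof (intro conjI ballI allI)
    fix A A' :: "real ^ 'n ^ 'n" and c
    assume A: "A \<in> sym_matrices"
    show "T A \<in> sym_matrices"
      using A by (rule T_sym)
    show "T (c *\<^sub>R A) = c *\<^sub>R T A"
      \<comment> \<open>The formula for \<open>T\<close> is available on symmetric arguments only,
        so closure of \<open>sym_matrices\<close> comes first.\<close>
      using T[OF A] T[OF subspace_scale[OF subspace_sym_matrices A, of c]]
      by (simp add: scaleR_sum_right trace_scaleR flip: scalar_matrix_assoc)
    assume A': "A' \<in> sym_matrices"
    show "T (A + A') = T A + T A'"
      using T[OF A] T[OF A'] T[OF subspace_add[OF subspace_sym_matrices A A']]
      by (simp add: matrix_add_rdistrib trace_add scaleR_add_left sum.distrib)
  qed
  moreover have "positive_definite (T A)" if A: "A \<in> sym_matrices" "positive_definite A" for A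
    unfolding positive_definite_def
  proof (intro conjI allI impI)
    show "T A \<in> sym_matrices"
      using A(1) by (rule T_sym)
    fix x :: "real ^ 'n"
    assume x: "x \<noteq> 0"
    define t where "t k = trace (A ** B k)" for k
    define l where "l k = (if t k \<ge> 0 then lambda_min (U k) else lambda_max (U k))" for k
    define C where "C = (\<Sum>k = 1..r. l k *\<^sub>R B k)"
    have "C \<noteq> 0 \<and> positive_semidefinite C"
      \<comment> \<open>The signs of the \<open>t k\<close> may form any pattern, which is why the
        hypothesis must allow independent choices for different \<open>k\<close>.\<close>
      unfolding C_def by (rule pos) (simp add: l_def)
    then have "0 < trace (A ** C)"
      using trace_positive_definite_mult A(2) by blast
    with x have "0 < trace (A ** C) * (x \<bullet> x)"
      by simp
    also have "trace (A ** C) = (\<Sum>k = 1..r. t k * l k)"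
      by (simp add: C_def sum_matrix_mult_right trace_sum t_def matrix_scalar_ac trace_scaleR
          mult.commute flip: scalar_matrix_assoc)
    also have "\<dots> * (x \<bullet> x) = (\<Sum>k = 1..r. t k * (l k * (x \<bullet> x)))"
      by (simp add: sum_distrib_right mult.assoc)
    also have "\<dots> \<le> (\<Sum>k = 1..r. t k * (x \<bullet> (U k *v x)))"
    proof (rule sum_mono)
      fix k
      assume "k \<in> {1..r}"
      then show "t k * (l k * (x \<bullet> x)) \<le> t k * (x \<bullet> (U k *v x))"
        \<comment> \<open>A negative \<open>t k\<close> reverses the inequality, so there the upper
          Rayleigh bound yields the lower estimate.\<close>
        using lambda_min_le_Rayleigh[OF U, of k x] Rayleigh_le_lambda_max[OF U, of k x]
        by (auto simp: l_def intro: mult_left_mono mult_left_mono_neg)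
    qed
    also have "\<dots> = x \<bullet> (T A *v x)"
      by (simp add: T[OF A(1)] sum_matrix_vector_mult inner_sum_right t_def
          flip: scaleR_matrix_vector_assoc)
    finally show "0 < x \<bullet> (T A *v x)" .
  qed
  ultimately show ?thesis
    by (simp add: positive_definite_preserving_def)
qed

end
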